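(* Let $K$ be a field of characteristic $0$ and let $m=2p+1$ be a positive odd integer. For $-p\le r\le p$ let $S_r$ be the $(p+1)\times(p+1)$ matrix over $K$ with $S_r(j,k)=1$ if $j=k+r$ and $S_r(j,k)=0$ otherwise. Let $Q_r=S_r\oplus S_r\in\operatorname{Mat}_{2p+2,2p+2}(K)$ (block diagonal), and let $\widetilde{Q}_r\in\operatorname{Mat}_{2p+1,2p+1}(K)$ be the matrix obtained from $Q_r$ by removing its last row and last column. Identify $\operatorname{Mat}_{m,m}(K)$ with $K^m\otimes K^m$ and let $e_1,\dots,e_m$ be the standard basis of $K^m$. Then the tensor $$T=\sum_{i=1}^m e_i\otimes\widetilde{Q}_{i-p-1}\in K^m\otimes K^m\otimes K^m$$ has border rank $\ge 2m-3$.
   Context: The tensor rank of a tensor is the smallest $r$ such that it is a sum of $r$ pure tensors. Let $Z_r$ be the set of tensors of tensor rank $\le r$ in $K^m\otimes K^m\otimes K^m$ and $\overline{Z_r}$ its Zariski closure; the border rank of $T$ is the smallest $r$ with $T\in\overline{Z_r}$. The identification $\operatorname{Mat}_{m,m}(K)\cong K^m\otimes K^m$ sends the matrix unit $E_{jk}$ to $e_j\otimes e_k$. *)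

theory Defs
  imports "Jordan_Normal_Form.Determinant"
begin

text \<open>
  For a finite index set \<open>I\<close>, the space \<open>K\<^sup>I\<close> is represented by the functions on the index type
  that vanish outside \<open>I\<close>.  Thus \<open>K\<^sup>m \<otimes> K\<^sup>m \<otimes> K\<^sup>m\<close> is the space with index set
  \<open>{..<m} \<times> {..<m} \<times> {..<m}\<close>, and indices start at 0.
\<close>

definition coord_space :: "'i set \<Rightarrow> ('i \<Rightarrow> 'k :: field) set" where
  "coord_space I = {x. \<forall>i. i \<notin> I \<longrightarrow> x i = 0}"

definition vec_coords :: "'k :: field vec \<Rightarrow> nat \<Rightarrow> 'k" where
  "vec_coords v = (\<lambda>i. if i < dim_vec v then v $ i else 0)"

definition mat_coords :: "'k :: field mat \<Rightarrow> nat \<times> nat \<Rightarrow> 'k" where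
  "mat_coords A = (\<lambda>(j, k). if j < dim_row A \<and> k < dim_col A then A $$ (j, k) else 0)"

definition tensor_prod ::
    "('i \<Rightarrow> 'k :: field) \<Rightarrow> ('j \<Rightarrow> 'k) \<Rightarrow> 'i \<times> 'j \<Rightarrow> 'k" (infixr "\<otimes>\<^sub>t" 70) where
  "x \<otimes>\<^sub>t y = (\<lambda>(i, j). x i * y j)"

text \<open>The identification of matrices with order-two tensors sends \<open>E\<^sub>j\<^sub>k\<close> to \<open>e\<^sub>j \<otimes> e\<^sub>k\<close>.\<close>

lemma mat_coords_matrix_unit:
  assumes "j < m" "k < m"
  shows "mat_coords (mat m m (\<lambda>jk. if jk = (j, k) then 1 else 0)) =
    vec_coords (unit_vec m j) \<otimes>\<^sub>t vec_coords (unit_vec m k)"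
  using assms by (auto simp: fun_eq_iff mat_coords_def vec_coords_def tensor_prod_def)

definition tensor_space :: "nat \<Rightarrow> (nat \<times> nat \<times> nat \<Rightarrow> 'k :: field) set" where
  "tensor_space m = coord_space ({..<m} \<times> {..<m} \<times> {..<m})"

definition pure_tensors :: "nat \<Rightarrow> (nat \<times> nat \<times> nat \<Rightarrow> 'k :: field) set" where
  "pure_tensors m = {vec_coords u \<otimes>\<^sub>t vec_coords v \<otimes>\<^sub>t vec_coords w | u v w.
     u \<in> carrier_vec m \<and> v \<in> carrier_vec m \<and> w \<in> carrier_vec m}"

definition tensor_rank :: "nat \<Rightarrow> (nat \<times> nat \<times> nat \<Rightarrow> 'k :: field) \<Rightarrow> nat" where
  "tensor_rank m T = (LEAST r. \<exists>t. (\<forall>l<r. t l \<in> pure_tensors m) \<and> T = (\<lambda>x. \<Sum>l<r. t l x))"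

inductive_set polynomial_funs :: "'i set \<Rightarrow> (('i \<Rightarrow> 'k :: field) \<Rightarrow> 'k) set" for I :: "'i set" where
  const: "(\<lambda>x. c) \<in> polynomial_funs I"
| coord: "i \<in> I \<Longrightarrow> (\<lambda>x. x i) \<in> polynomial_funs I"
| add: "f \<in> polynomial_funs I \<Longrightarrow> g \<in> polynomial_funs I \<Longrightarrow> (\<lambda>x. f x + g x) \<in> polynomial_funs I"
| mult: "f \<in> polynomial_funs I \<Longrightarrow> g \<in> polynomial_funs I \<Longrightarrow> (\<lambda>x. f x * g x) \<in> polynomial_funs I"

text \<open>
  Closed subsets of the \<open>K\<close>-points of affine space: the defining polynomials have coefficients
  in \<open>K\<close> itself, which need not be algebraically closed.
\<close>

definition zariski_closed :: "'i set \<Rightarrow> ('i \<Rightarrow> 'k :: field) set \<Rightarrow> bool" where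
  "zariski_closed I C \<longleftrightarrow>
     (\<exists>F \<subseteq> polynomial_funs I. C = {x \<in> coord_space I. \<forall>f\<in>F. f x = 0})"

definition zariski_closure :: "'i set \<Rightarrow> ('i \<Rightarrow> 'k :: field) set \<Rightarrow> ('i \<Rightarrow> 'k) set" where
  "zariski_closure I Z = zariski_closed I hull Z"

definition rank_le :: "nat \<Rightarrow> nat \<Rightarrow> (nat \<times> nat \<times> nat \<Rightarrow> 'k :: field) set" where
  "rank_le m r = {T \<in> tensor_space m. tensor_rank m T \<le> r}"

definition border_rank :: "nat \<Rightarrow> (nat \<times> nat \<times> nat \<Rightarrow> 'k :: field) \<Rightarrow> nat" where
  "border_rank m T =
     (LEAST r. T \<in> zariski_closure ({..<m} \<times> {..<m} \<times> {..<m}) (rank_le m r))"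

text \<open>The condition \<open>j = k + r\<close> is unaffected by starting the indices at 0 instead of 1.\<close>

definition S_mat :: "nat \<Rightarrow> int \<Rightarrow> 'k :: field mat" where
  "S_mat p r = mat (p + 1) (p + 1) (\<lambda>(j, k). if int j = int k + r then 1 else 0)"

definition Q_mat :: "nat \<Rightarrow> int \<Rightarrow> 'k :: field mat" where
  "Q_mat p r = diag_block_mat [S_mat p r, S_mat p r]"

definition Q_tilde :: "nat \<Rightarrow> int \<Rightarrow> 'k :: field mat" where
  "Q_tilde p r = mat_delete (Q_mat p r) (2 * p + 1) (2 * p + 1)"

end

theory Submission
  imports Defs
begin

text \<open>
  The bound comes from a polynomial, the determinant of a Koszul flattening, that vanishes on all
  tensors of small rank but not at \<open>T\<close>.

  Let \<open>V = K\<^sup>m\<close> with \<open>m = 2p + 1\<close>.  The Koszul flattening of a tensor \<open>\<Sum>\<^sub>i e\<^sub>i \<otimes> A\<^sub>i\<close> whose slices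
  \<open>A\<^sub>i\<close> are square matrices of size \<open>N\<close> is the linear map from \<open>N\<close>-tuples in the \<open>p\<close>-th exterior
  power of \<open>V\<close> to \<open>N\<close>-tuples in the \<open>(p + 1)\<close>-st one,
  \<open>(\<omega>\<^sub>k)\<^sub>k \<mapsto> (\<Sum>\<^sub>k \<Sum>\<^sub>i A\<^sub>i(j, k) e\<^sub>i \<and> \<omega>\<^sub>k)\<^sub>j\<close>.  It is a square system, because both exterior powers have
  dimension \<open>m choose p\<close>.  A pure tensor \<open>u \<otimes> v \<otimes> w\<close> contributes
  \<open>u \<and> (\<Sum>\<^sub>k w\<^sub>k \<omega>\<^sub>k)\<close> times \<open>v\<close>, a map of rank at most \<open>2p choose p\<close> (\<open>wedge_pivot\<close>), so a small rank
  of the tensor forces a small rank of the flattening.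

  For the slices \<open>Q\<^sub>r\<close>, of size \<open>2p + 2\<close>, the flattening is nonsingular.  It splits into two copies
  of the flattening for the slices \<open>S\<^sub>r\<close>, which up to the order of the columns is the Hankel matrix
  \<open>(e\<^bsub>j+k\<^esub>)\<close> acting by exterior multiplication; its injectivity is \<open>hankel_koszul_injective\<close>.
  The tensor \<open>T\<close> lacks the last row and column of every \<open>Q\<^sub>r\<close>.  These are put back as constants:
  a tensor \<open>t\<close> is bordered by the last rows and columns of the \<open>Q\<^sub>r\<close>, whatever \<open>t\<close> is, and the
  determinant of the flattening of the bordered tensor is a polynomial function of \<open>t\<close> that does
  not vanish at \<open>T\<close>.  If \<open>t\<close> has rank at most \<open>r\<close>, the border adds at most \<open>2 (m choose p)\<close> to the
  rank of its flattening, so the determinant vanishes as soon as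
  \<open>r (2p choose p) + 2 (m choose p) < (2p + 2) (m choose p)\<close>.  As
  \<open>(p + 1) (m choose p) = m (2p choose p)\<close>, this says \<open>r (p + 1) < 2p (2p + 1)\<close>, which holds for
  \<open>r \<le> 4p - 2 = 2m - 4\<close>.  The determinant then vanishes on the Zariski closure of the tensors of rank
  at most \<open>2m - 4\<close>, and \<open>T\<close> is not in it.
\<close>

section \<open>Polynomial functions and Zariski closures\<close>

lemma polynomial_funs_sum:
  assumes "\<And>a. a \<in> A \<Longrightarrow> f a \<in> polynomial_funs I"
  shows "(\<lambda>x. \<Sum>a\<in>A. f a x) \<in> polynomial_funs I"
  using assms
proof (induction A rule: infinite_finite_induct)
  case (insert a A)
  then have "(\<lambda>x. f a x + (\<Sum>a\<in>A. f a x)) \<in> polynomial_funs I"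
    by (intro polynomial_funs.add) auto
  then show ?case using insert by simp
qed (auto intro: polynomial_funs.const)

lemma polynomial_funs_prod:
  assumes "\<And>a. a \<in> A \<Longrightarrow> f a \<in> polynomial_funs I"
  shows "(\<lambda>x. \<Prod>a\<in>A. f a x) \<in> polynomial_funs I"
  using assms
proof (induction A rule: infinite_finite_induct)
  case (insert a A)
  then have "(\<lambda>x. f a x * (\<Prod>a\<in>A. f a x)) \<in> polynomial_funs I"
    by (intro polynomial_funs.mult) auto
  then show ?case using insert by simp
qed (auto intro: polynomial_funs.const)

lemma polynomial_funs_det:
  assumes "\<And>i j. i < n \<Longrightarrow> j < n \<Longrightarrow> (\<lambda>x. A x i j) \<in> polynomial_funs I"
  shows "(\<lambda>x. det (mat n n (\<lambda>(i, j). A x i j))) \<in> polynomial_funs I"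
proof -
  have "(\<lambda>x. \<Sum>\<pi> | \<pi> permutes {0..<n}. signof \<pi> * (\<Prod>i = 0..<n. A x i (\<pi> i)))
      \<in> polynomial_funs I"
  proof (intro polynomial_funs_sum polynomial_funs.mult polynomial_funs.const
      polynomial_funs_prod)
    fix \<pi> i assume "\<pi> \<in> {\<pi>. \<pi> permutes {0..<n}}" "i \<in> {0..<n}"
    then have "i < n" "\<pi> i < n" by (auto dest: permutes_in_image[of _ _ i])
    then show "(\<lambda>x. A x i (\<pi> i)) \<in> polynomial_funs I" by (rule assms)
  qed
  moreover have "det (mat n n (\<lambda>(i, j). A x i j)) =
      (\<Sum>\<pi> | \<pi> permutes {0..<n}. signof \<pi> * (\<Prod>i = 0..<n. A x i (\<pi> i)))" for x
    by (subst det_def') (auto intro!: sum.cong prod.cong dest: permutes_in_image)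
  ultimately show ?thesis by simp
qed

lemma polynomial_fun_vanishes_on_zariski_closure:
  assumes f: "f \<in> polynomial_funs I" and Z: "Z \<subseteq> coord_space I"
    and "\<And>x. x \<in> Z \<Longrightarrow> f x = 0" and x: "x \<in> zariski_closure I Z"
  shows "f x = 0"
proof -
  have "zariski_closed I {x \<in> coord_space I. f x = 0}"
    unfolding zariski_closed_def using f by (intro exI[of _ "{f}"]) auto
  then have "zariski_closure I Z \<subseteq> {x \<in> coord_space I. f x = 0}"
    unfolding zariski_closure_def using assms by (intro hull_minimal) auto
  then show ?thesis using x by auto
qed

section \<open>Homogeneous linear systems\<close>

definition linear_form :: "'x set \<Rightarrow> (('x \<Rightarrow> 'k :: field) \<Rightarrow> 'k) \<Rightarrow> bool" where
  "linear_form X F \<longleftrightarrow> (\<exists>c. \<forall>z. F z = (\<Sum>x\<in>X. c x * z x))"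

lemma linear_form_coord:
  assumes "finite X" "x \<in> X"
  shows "linear_form X (\<lambda>z. z x)"
  unfolding linear_form_def
  by (rule exI[of _ "\<lambda>y. of_bool (y = x)"]) (simp add: assms of_bool_def if_distrib if_distribR cong: if_cong)

lemma linear_form_scale:
  assumes "linear_form X F"
  shows "linear_form X (\<lambda>z. a * F z)"
proof -
  obtain c where "\<And>z. F z = (\<Sum>x\<in>X. c x * z x)" using assms by (auto simp: linear_form_def)
  then show ?thesis unfolding linear_form_def
    by (intro exI[of _ "\<lambda>x. a * c x"]) (simp add: sum_distrib_left mult.assoc)
qed

lemma linear_form_sum:
  assumes "\<And>a. a \<in> A \<Longrightarrow> linear_form X (F a)"
  shows "linear_form X (\<lambda>z. \<Sum>a\<in>A. F a z)"
proof -
  obtain c where c: "\<And>a z. a \<in> A \<Longrightarrow> F a z = (\<Sum>x\<in>X. c a x * z x)"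
    using assms unfolding linear_form_def by metis
  have "(\<Sum>a\<in>A. F a z) = (\<Sum>x\<in>X. (\<Sum>a\<in>A. c a x) * z x)" for z
    by (simp add: c sum_distrib_right sum.swap[of _ A X])
  then show ?thesis unfolding linear_form_def
    by (intro exI[of _ "\<lambda>x. \<Sum>a\<in>A. c a x"]) simp
qed

lemma linear_form_expand:
  assumes "finite X" "linear_form X F"
  shows "F z = (\<Sum>x\<in>X. F (\<lambda>y. of_bool (y = x)) * z x)"
proof -
  obtain c where c: "\<And>z. F z = (\<Sum>x\<in>X. c x * z x)" using assms by (auto simp: linear_form_def)
  have "F (\<lambda>y. of_bool (y = x)) = c x" if "x \<in> X" for x
    using that assms(1) by (simp add: c of_bool_def if_distrib cong: if_cong)
  then show ?thesis by (simp add: c[of z])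
qed

lemma square_system_det_eq_0_iff:
  fixes F :: "nat \<Rightarrow> ('x \<Rightarrow> 'k :: field) \<Rightarrow> 'k"
  assumes h: "bij_betw h {..<n} X" and F: "\<And>i. i < n \<Longrightarrow> linear_form X (F i)"
  shows "det (mat n n (\<lambda>(i, j). F i (\<lambda>y. of_bool (y = h j)))) = 0 \<longleftrightarrow>
    (\<exists>z. (\<exists>x\<in>X. z x \<noteq> 0) \<and> (\<forall>i<n. F i z = 0))"
proof -
  let ?A = "mat n n (\<lambda>(i, j). F i (\<lambda>y. of_bool (y = h j)))"
  have fin: "finite X" using h bij_betw_finite by auto
  have expand: "F i z = (\<Sum>j<n. F i (\<lambda>y. of_bool (y = h j)) * z (h j))" if "i < n" for i z
    by (subst linear_form_expand[OF fin F[OF that]])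
      (rule sum.reindex_bij_betw[OF h, symmetric])
  have row: "(?A *\<^sub>v v) $ i = F i z" if "i < n" "v \<in> carrier_vec n" "\<And>j. j < n \<Longrightarrow> v $ j = z (h j)"
    for i v z
    by (subst expand[OF that(1)]) (use that in \<open>simp add: scalar_prod_def atLeast0LessThan\<close>)
  have "det ?A = 0 \<longleftrightarrow> (\<exists>v. v \<in> carrier_vec n \<and> v \<noteq> 0\<^sub>v n \<and> ?A *\<^sub>v v = 0\<^sub>v n)"
    by (intro det_0_iff_vec_prod_zero_field) auto
  also have "\<dots> \<longleftrightarrow> (\<exists>z. (\<exists>x\<in>X. z x \<noteq> 0) \<and> (\<forall>i<n. F i z = 0))"
  proof
    assume "\<exists>v. v \<in> carrier_vec n \<and> v \<noteq> 0\<^sub>v n \<and> ?A *\<^sub>v v = 0\<^sub>v n"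
    then obtain v where v: "v \<in> carrier_vec n" "v \<noteq> 0\<^sub>v n" "?A *\<^sub>v v = 0\<^sub>v n" by auto
    define z where "z x = v $ (the_inv_into {..<n} h x)" for x
    have z: "v $ j = z (h j)" if "j < n" for j
      using that h by (simp add: z_def bij_betw_def the_inv_into_f_f)
    obtain j where "j < n" "v $ j \<noteq> 0" using v by (auto simp: vec_eq_iff)
    then have "\<exists>x\<in>X. z x \<noteq> 0" using z bij_betwE[OF h] by auto
    moreover have "F i z = 0" if "i < n" for i using row[OF that v(1) z] v(3) that by simp
    ultimately show "\<exists>z. (\<exists>x\<in>X. z x \<noteq> 0) \<and> (\<forall>i<n. F i z = 0)" by blast
  next
    assume "\<exists>z. (\<exists>x\<in>X. z x \<noteq> 0) \<and> (\<forall>i<n. F i z = 0)"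
    then obtain z x where z: "x \<in> X" "z x \<noteq> 0" "\<And>i. i < n \<Longrightarrow> F i z = 0" by auto
    then obtain j where j: "j < n" "h j = x" using h by (auto simp: bij_betw_def)
    define v where "v = vec n (\<lambda>j. z (h j))"
    have "v $ j \<noteq> 0" using j z by (simp add: v_def)
    then have "v \<noteq> 0\<^sub>v n" using j by auto
    moreover have "?A *\<^sub>v v = 0\<^sub>v n"
    proof (rule eq_vecI)
      fix i assume "i < dim_vec (0\<^sub>v n :: 'k vec)"
      then have "i < n" by simp
      then show "(?A *\<^sub>v v) $ i = 0\<^sub>v n $ i" using row[of i v z] z(3) by (simp add: v_def)
    qed simp
    ultimately show "\<exists>v. v \<in> carrier_vec n \<and> v \<noteq> 0\<^sub>v n \<and> ?A *\<^sub>v v = 0\<^sub>v n"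
      by (auto simp: v_def intro!: exI[of _ v])
  qed
  finally show ?thesis .
qed

lemma underdetermined_system_has_solution:
  fixes \<F> :: "(('x \<Rightarrow> 'k :: field) \<Rightarrow> 'k) set"
  assumes fin: "finite X" "finite \<F>" and card: "card \<F> < card X"
    and lin: "\<And>F. F \<in> \<F> \<Longrightarrow> linear_form X F"
  shows "\<exists>z. (\<exists>x\<in>X. z x \<noteq> 0) \<and> (\<forall>F\<in>\<F>. F z = 0)"
proof -
  obtain h where h: "bij_betw h {..<card X} X"
    using ex_bij_betw_nat_finite[OF fin(1)] by (auto simp: atLeast0LessThan)
  obtain g where g: "bij_betw g {..<card \<F>} \<F>"
    using ex_bij_betw_nat_finite[OF fin(2)] by (auto simp: atLeast0LessThan)
  \<comment> \<open>Padding with zero forms makes the system square, with a zero row.\<close>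
  define F where "F i = (if i < card \<F> then g i else (\<lambda>_. 0))" for i
  have "linear_form X (F i)" for i
    using lin bij_betwE[OF g] by (auto simp: F_def linear_form_def intro!: exI[of _ "\<lambda>_. 0"])
  note det_iff = square_system_det_eq_0_iff[OF h this]
  let ?A = "mat (card X) (card X) (\<lambda>(i, j). F i (\<lambda>y. of_bool (y = h j)))"
  have "?A\<^sup>T *\<^sub>v unit_vec (card X) (card \<F>) = 0\<^sub>v (card X)"
    using card by (intro eq_vecI) (auto simp: F_def)
  moreover have "unit_vec (card X) (card \<F>) \<noteq> (0\<^sub>v (card X) :: 'k vec)" using card by simp
  ultimately have "det ?A\<^sup>T = 0"
    by (subst det_0_iff_vec_prod_zero_field[of _ "card X"]) (auto intro!: exI[of _ "unit_vec (card X) (card \<F>)"])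
  then have "det ?A = 0" by (subst (asm) det_transpose[of _ "card X"]) auto
  then obtain z where z: "\<exists>x\<in>X. z x \<noteq> 0" "\<And>i. i < card X \<Longrightarrow> F i z = 0"
    using det_iff by auto
  have "G z = 0" if "G \<in> \<F>" for G
  proof -
    have "G \<in> g ` {..<card \<F>}" using g that by (simp add: bij_betw_def)
    then obtain i where "i < card \<F>" "g i = G" by auto
    then show ?thesis using z(2)[of i] card by (simp add: F_def)
  qed
  then show ?thesis using z by blast
qed

text \<open>
  The polynomial is the determinant of the coefficient matrix, whose entries are the values of the
  linear forms at the unit vectors.
\<close>

lemma singular_locus_polynomial:
  fixes F :: "('i \<Rightarrow> 'k :: field) \<Rightarrow> 'y \<Rightarrow> ('x \<Rightarrow> 'k) \<Rightarrow> 'k"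
  assumes fin: "finite X" "finite Y" and card: "card Y = card X"
    and lin: "\<And>t y. y \<in> Y \<Longrightarrow> linear_form X (F t y)"
    and poly: "\<And>y z. y \<in> Y \<Longrightarrow> (\<lambda>t. F t y z) \<in> polynomial_funs I"
  obtains f where "f \<in> polynomial_funs I"
    and "\<And>t. f t = 0 \<longleftrightarrow> (\<exists>z. (\<exists>x\<in>X. z x \<noteq> 0) \<and> (\<forall>y\<in>Y. F t y z = 0))"
proof -
  define n where "n = card X"
  obtain h where h: "bij_betw h {..<n} X"
    using ex_bij_betw_nat_finite[OF fin(1)] by (auto simp: atLeast0LessThan n_def)
  obtain g where g: "bij_betw g {..<n} Y"
    using ex_bij_betw_nat_finite[OF fin(2)] by (auto simp: atLeast0LessThan n_def card)
  have gY: "g i \<in> Y" if "i < n" for i using bij_betwE[OF g] that by auto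
  define f where "f t = det (mat n n (\<lambda>(i, j). F t (g i) (\<lambda>y. of_bool (y = h j))))" for t
  have "f \<in> polynomial_funs I"
    unfolding f_def by (intro polynomial_funs_det poly gY)
  moreover have "f t = 0 \<longleftrightarrow> (\<exists>z. (\<exists>x\<in>X. z x \<noteq> 0) \<and> (\<forall>y\<in>Y. F t y z = 0))" for t
  proof -
    have "(\<forall>i<n. F t (g i) z = 0) \<longleftrightarrow> (\<forall>y\<in>Y. F t y z = 0)" for z
      using g by (auto simp: bij_betw_def)
    then show ?thesis
      unfolding f_def using square_system_det_eq_0_iff[OF h, of "\<lambda>i. F t (g i)"] lin gY by auto
  qed
  ultimately show ?thesis by (rule that)
qed

section \<open>Exterior multiplication in coordinates\<close>

definition subsets_of_size :: "nat \<Rightarrow> nat \<Rightarrow> nat set set" where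
  "subsets_of_size n q = {I. I \<subseteq> {..<n} \<and> card I = q}"

text \<open>
  This is the sign in \<open>e\<^sub>i \<and> e\<^bsub>J - {i}\<^esub> = \<plusminus> e\<^sub>J\<close>, where \<open>e\<^sub>I\<close> is the exterior product of the \<open>e\<^sub>i\<close> with
  \<open>i \<in> I\<close> in increasing order.
\<close>

definition insert_sign :: "nat \<Rightarrow> nat set \<Rightarrow> 'k :: comm_ring_1" where
  "insert_sign i J = (- 1) ^ card {j \<in> J. j < i}"

text \<open>
  An element of an exterior power is represented by its coordinates with respect to the
  basis \<open>e\<^sub>I\<close>.  A degree-\<open>q\<close> element thus is a function of which only the values at the \<open>q\<close>-element
  index sets matter, and no degree is part of the data.
\<close>

definition wedge :: "(nat \<Rightarrow> 'k :: comm_ring_1) \<Rightarrow> (nat set \<Rightarrow> 'k) \<Rightarrow> nat set \<Rightarrow> 'k" where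
  "wedge u \<omega> J = (\<Sum>i\<in>J. insert_sign i J * u i * \<omega> (J - {i}))"

abbreviation basis_vec :: "nat \<Rightarrow> nat \<Rightarrow> 'k :: comm_ring_1" where
  "basis_vec c \<equiv> (\<lambda>i. of_bool (i = c))"

lemma finite_subsets_of_size: "finite (subsets_of_size n q)"
  unfolding subsets_of_size_def by simp

lemma card_subsets_of_size: "card (subsets_of_size n q) = n choose q"
  unfolding subsets_of_size_def using n_subsets[of "{..<n}" q] by simp

lemma finite_if_subsets_of_size: "I \<in> subsets_of_size n q \<Longrightarrow> finite I"
  unfolding subsets_of_size_def using finite_subset by blast

lemma Diff_subsets_of_size:
  assumes "J \<in> subsets_of_size n (Suc q)" "i \<in> J"
  shows "J - {i} \<in> subsets_of_size n q"
  using assms finite_if_subsets_of_size[OF assms(1)] by (auto simp: subsets_of_size_def)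

lemma insert_subsets_of_size:
  assumes "J \<in> subsets_of_size n q" "i \<notin> J" "i < n"
  shows "insert i J \<in> subsets_of_size n (Suc q)"
  using assms finite_if_subsets_of_size[OF assms(1)] by (auto simp: subsets_of_size_def)

lemma card_subsets_of_size_through:
  assumes "i < n"
  shows "card {J \<in> subsets_of_size n (Suc q). i \<in> J} = (n - 1) choose q"
proof -
  have "bij_betw (insert i) {I. I \<subseteq> {..<n} - {i} \<and> card I = q} {J \<in> subsets_of_size n (Suc q). i \<in> J}"
  proof (rule bij_betwI[where g = "\<lambda>J. J - {i}"])
    show "insert i \<in> {I. I \<subseteq> {..<n} - {i} \<and> card I = q} \<rightarrow> {J \<in> subsets_of_size n (Suc q). i \<in> J}"
    proof
      fix I assume I: "I \<in> {I. I \<subseteq> {..<n} - {i} \<and> card I = q}"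
      then have "I \<in> subsets_of_size n q" "i \<notin> I" by (auto simp: subsets_of_size_def)
      then show "insert i I \<in> {J \<in> subsets_of_size n (Suc q). i \<in> J}"
        using insert_subsets_of_size assms by auto
    qed
    show "(\<lambda>J. J - {i}) \<in> {J \<in> subsets_of_size n (Suc q). i \<in> J} \<rightarrow> {I. I \<subseteq> {..<n} - {i} \<and> card I = q}"
    proof
      fix J assume "J \<in> {J \<in> subsets_of_size n (Suc q). i \<in> J}"
      then have "J - {i} \<in> subsets_of_size n q" using Diff_subsets_of_size by auto
      then show "J - {i} \<in> {I. I \<subseteq> {..<n} - {i} \<and> card I = q}" by (auto simp: subsets_of_size_def)
    qed
  qed auto
  then have "card {J \<in> subsets_of_size n (Suc q). i \<in> J} = card {I. I \<subseteq> {..<n} - {i} \<and> card I = q}"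
    by (simp add: bij_betw_same_card)
  also have "\<dots> = (n - 1) choose q" using assms n_subsets[of "{..<n} - {i}" q] by simp
  finally show ?thesis .
qed

lemma wedge_cong:
  assumes "\<And>i. i \<in> J \<Longrightarrow> u i = u' i" "\<And>i. i \<in> J \<Longrightarrow> \<omega> (J - {i}) = \<omega>' (J - {i})"
  shows "wedge u \<omega> J = wedge u' \<omega>' J"
  unfolding wedge_def using assms by (intro sum.cong) auto

lemma wedge_eq_0:
  assumes "\<And>i. i \<in> J \<Longrightarrow> u i = 0 \<or> \<omega> (J - {i}) = 0"
  shows "wedge u \<omega> J = 0"
  unfolding wedge_def using assms by (intro sum.neutral ballI) fastforce

lemma wedge_basis_vec:
  assumes "finite J"
  shows "wedge (basis_vec c) \<omega> J = (if c \<in> J then insert_sign c J * \<omega> (J - {c}) else 0)"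
proof -
  have "wedge (basis_vec c) \<omega> J = (\<Sum>i\<in>J. if i = c then insert_sign i J * \<omega> (J - {i}) else 0)"
    unfolding wedge_def by (intro sum.cong) auto
  then show ?thesis using assms by simp
qed

lemma wedge_sum_left:
  "wedge (\<lambda>i. \<Sum>a\<in>A. u a i) \<omega> J = (\<Sum>a\<in>A. wedge (u a) \<omega> J)"
  unfolding wedge_def by (simp add: sum_distrib_left sum_distrib_right sum.swap[of _ J A])

lemma wedge_scale_left:
  "wedge (\<lambda>i. a * u i) \<omega> J = a * wedge u \<omega> J"
  unfolding wedge_def by (simp add: sum_distrib_left mult_ac)

lemma wedge_sum_right:
  "wedge u (\<lambda>I. \<Sum>a\<in>A. c a * \<omega> a I) J = (\<Sum>a\<in>A. c a * wedge u (\<omega> a) J)"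
  unfolding wedge_def by (simp add: sum_distrib_left sum.swap[of _ J A] mult_ac)

lemma linear_form_wedge:
  assumes "finite X" "\<And>i. i \<in> J \<Longrightarrow> (k, J - {i}) \<in> X"
  shows "linear_form X (\<lambda>z. wedge u (\<lambda>I. z (k, I)) J)"
  unfolding wedge_def by (intro linear_form_sum linear_form_scale linear_form_coord assms)

lemma insert_sign_min:
  assumes "\<And>j. j \<in> J \<Longrightarrow> s \<le> j"
  shows "insert_sign s J = 1"
proof -
  have "{j \<in> J. j < s} = {}" using assms by fastforce
  then show ?thesis unfolding insert_sign_def by (metis card.empty power_0)
qed

lemma insert_sign_insert:
  assumes "finite J" "s \<notin> J"
  shows "insert_sign i (insert s J) = (if s < i then - insert_sign i J else insert_sign i J)"
proof -
  have "{j \<in> insert s J. j < i} = (if s < i then insert s {j \<in> J. j < i} else {j \<in> J. j < i})"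
    by auto
  then show ?thesis using assms by (simp add: insert_sign_def)
qed

text \<open>
  With \<open>L = J - {i, j}\<close>, the two products are the signs that sort \<open>e\<^sub>j \<and> e\<^sub>i \<and> e\<^sub>L\<close> and
  \<open>e\<^sub>i \<and> e\<^sub>j \<and> e\<^sub>L\<close> into \<open>e\<^sub>J\<close>, and \<open>e\<^sub>j \<and> e\<^sub>i = - e\<^sub>i \<and> e\<^sub>j\<close>.
\<close>

lemma insert_sign_swap:
  assumes "finite J" "i \<in> J" "j \<in> J" "i \<noteq> j"
  shows "insert_sign j J * insert_sign i (J - {j}) =
    - (insert_sign i J * insert_sign j (J - {i}) :: 'k :: comm_ring_1)"
proof -
  let ?s = "insert_sign :: nat \<Rightarrow> nat set \<Rightarrow> 'k"
  define L where "L = J - {i, j}"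
  have L: "finite L" "i \<notin> L" "j \<notin> L" "J = insert i (insert j L)"
    "J - {i} = insert j L" "J - {j} = insert i L"
    using assms by (auto simp: L_def)
  have J': "insert i (insert j L) = insert j (insert i L)" by auto
  have *: "?s i (insert i L) = ?s i L" for i L
  proof -
    have "{j \<in> insert i L. j < i} = {j \<in> L. j < i}" by auto
    then show ?thesis by (simp add: insert_sign_def)
  qed
  have "?s i J = ?s i (insert j L)" "?s j J = ?s j (insert i L)"
    using * J' L(4) by metis+
  then show ?thesis using L(1-3,5,6) assms(4)
    by (simp add: insert_sign_insert)
qed

text \<open>
  The double sum for \<open>u \<and> (u \<and> \<omega>)\<close> is antisymmetric in its two indices, so it equals its own
  negative; characteristic 0 then gives 0.
\<close>

lemma wedge_wedge_self:
  fixes u :: "nat \<Rightarrow> 'k :: field_char_0"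
  assumes "finite J"
  shows "wedge u (wedge u \<omega>) J = 0"
proof -
  define g where "g i j = (if i \<noteq> j then insert_sign i J * insert_sign j (J - {i}) * u i * u j * \<omega> (J - {i} - {j}) else 0)"
    for i j
  have "insert_sign i J * u i * wedge u \<omega> (J - {i}) = (\<Sum>j\<in>J. g i j)" if "i \<in> J" for i
  proof -
    have "(\<Sum>j\<in>J. g i j) = (\<Sum>j\<in>J - {i}. g i j)"
      using assms by (intro sum.mono_neutral_right) (auto simp: g_def)
    then show ?thesis by (simp add: wedge_def g_def sum_distrib_left mult_ac)
  qed
  then have *: "wedge u (wedge u \<omega>) J = (\<Sum>i\<in>J. \<Sum>j\<in>J. g i j)"
    by (subst wedge_def) (rule sum.cong, auto)
  have antisym: "g i j = - g j i" if "i \<in> J" "j \<in> J" for i j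
  proof (cases "i = j")
    case False
    have "J - {i} - {j} = J - {j} - {i}" by auto
    then show ?thesis
      using False insert_sign_swap[OF assms that(2,1), where 'k = 'k] by (simp add: g_def mult_ac)
  qed (simp add: g_def)
  have "(\<Sum>i\<in>J. \<Sum>j\<in>J. g i j) = (\<Sum>i\<in>J. \<Sum>j\<in>J. - g j i)"
    by (intro sum.cong refl antisym)
  also have "\<dots> = - (\<Sum>i\<in>J. \<Sum>j\<in>J. g i j)"
    by (subst sum.swap) (simp add: sum_negf)
  finally show ?thesis using * by simp
qed

text \<open>
  Multiplication by \<open>u\<close> has rank at most \<open>(n - 1) choose q\<close> in degree \<open>q\<close>: since
  \<open>u \<and> (u \<and> \<omega>) = 0\<close>, the coordinates of \<open>u \<and> \<omega>\<close> at the index sets that contain a position \<open>i\<close> with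
  \<open>u i \<noteq> 0\<close> determine all the others.
\<close>

lemma wedge_pivot:
  fixes u :: "nat \<Rightarrow> 'k :: field_char_0"
  assumes "n > 0"
  shows "\<exists>i<n. \<forall>\<omega>. (\<forall>J \<in> subsets_of_size n (Suc q). i \<in> J \<longrightarrow> wedge u \<omega> J = 0) \<longrightarrow>
    (\<forall>J \<in> subsets_of_size n (Suc q). wedge u \<omega> J = 0)"
proof (cases "\<exists>i<n. u i \<noteq> 0")
  case True
  then obtain i where i: "i < n" "u i \<noteq> 0" by auto
  have "wedge u \<omega> J = 0"
    if \<omega>: "\<And>J. J \<in> subsets_of_size n (Suc q) \<Longrightarrow> i \<in> J \<Longrightarrow> wedge u \<omega> J = 0"
      and J: "J \<in> subsets_of_size n (Suc q)" for \<omega> J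
  proof (cases "i \<in> J")
    case False
    let ?K = "insert i J"
    have K: "?K \<in> subsets_of_size n (Suc (Suc q))"
      using insert_subsets_of_size[OF J False i(1)] .
    then have fin: "finite ?K" by (rule finite_if_subsets_of_size)
    have "0 = wedge u (wedge u \<omega>) ?K" using wedge_wedge_self[OF fin] by simp
    also have "\<dots> = insert_sign i ?K * u i * wedge u \<omega> (?K - {i}) +
        (\<Sum>j\<in>?K - {i}. insert_sign j ?K * u j * wedge u \<omega> (?K - {j}))"
      by (subst (1) wedge_def) (rule sum.remove, use fin in auto)
    also have "(\<Sum>j\<in>?K - {i}. insert_sign j ?K * u j * wedge u \<omega> (?K - {j})) = 0"
    proof (intro sum.neutral ballI)
      fix j assume "j \<in> ?K - {i}"
      then have "wedge u \<omega> (?K - {j}) = 0" using Diff_subsets_of_size[OF K] by (intro \<omega>) auto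
      then show "insert_sign j ?K * u j * wedge u \<omega> (?K - {j}) = 0" by simp
    qed
    also have "?K - {i} = J" using False by auto
    finally show ?thesis using i by (simp add: insert_sign_def)
  qed (use \<omega> J in auto)
  then show ?thesis using i by blast
next
  case False
  then have "wedge u \<omega> J = 0" if "J \<in> subsets_of_size n (Suc q)" for \<omega> J
    using that by (intro wedge_eq_0) (auto simp: subsets_of_size_def)
  then show ?thesis using assms by blast
qed

section \<open>Nonsingularity of the Koszul flattening of a Hankel matrix\<close>

text \<open>
  The proof eliminates the first basis vector \<open>e\<^sub>s\<close>.  In the equations
  \<open>\<Sum>\<^sub>k e\<^bsub>s+j+k\<^esub> \<and> \<omega>\<^sub>k = 0\<close> it occurs in a single place, as the coefficient of \<open>\<omega>\<^sub>0\<close> for \<open>j = 0\<close>.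
  Contracting the equations \<open>j > 0\<close> with \<open>e\<^sub>s\<close> therefore yields the same
  kind of system for the contractions of the \<open>\<omega>\<^sub>k\<close>, with \<open>a - 1\<close> and \<open>q - 1\<close> in place of
  \<open>a\<close> and \<open>q\<close>; inductively these contractions vanish, so no \<open>\<omega>\<^sub>k\<close> involves \<open>e\<^sub>s\<close>.  In the equation
  \<open>j = 0\<close> the only term with \<open>e\<^sub>s\<close> is now \<open>e\<^sub>s \<and> \<omega>\<^sub>0\<close>, whence \<open>\<omega>\<^sub>0 = 0\<close>, and what remains is the
  same kind of system for the other \<open>b - 1\<close> unknowns.  The vectors are kept in the span of
  \<open>e\<^sub>s, \<dots>, e\<^bsub>n-1\<^esub>\<close>; the condition on \<open>n\<close> makes room for all of the \<open>e\<^bsub>s+j+k\<^esub>\<close>.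
\<close>

lemma hankel_koszul_injective:
  fixes \<omega> :: "nat \<Rightarrow> nat set \<Rightarrow> 'k :: comm_ring_1"
  assumes "q < a" and "s + a + b \<le> Suc n"
    and "\<And>j J. j < a \<Longrightarrow> J \<subseteq> {s..<n} \<Longrightarrow> card J = Suc q \<Longrightarrow>
      (\<Sum>k<b. wedge (basis_vec (s + j + k)) (\<omega> k) J) = 0"
    and "k < b" and "I \<subseteq> {s..<n}" and "card I = q"
  shows "\<omega> k I = 0"
  using assms
proof (induction "q + b" arbitrary: q a s b \<omega> k I rule: less_induct)
  case less
  note eq = less.prems(3)
  have s: "s < n" using less.prems by linarith
  have through_s: "\<omega> k I = 0" if k: "k < b" and I: "I \<subseteq> {s..<n}" "card I = q" "s \<in> I" for k I
  proof -
    have "finite I" using I finite_subset by blast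
    then obtain q' where q: "q = Suc q'" using I by (cases q) auto
    define \<eta> where "\<eta> k I = \<omega> k (insert s I)" for k I
    \<comment> \<open>\<open>\<eta>\<close> is the contraction; every sign flips under it because \<open>s\<close> precedes all other indices.\<close>
    have "\<eta> k (I - {s}) = 0"
    proof (rule less.hyps)
      show "q' + b < q + b" "q' < a - 1" "Suc s + (a - 1) + b \<le> Suc n" "k < b"
        using q less.prems k by auto
      show "I - {s} \<subseteq> {Suc s..<n}" "card (I - {s}) = q'"
        using I q \<open>finite I\<close> by (auto simp: Suc_le_eq le_neq_implies_less)
      fix j J assume j: "j < a - 1" and J: "J \<subseteq> {Suc s..<n}" "card J = Suc q'"
      have fin: "finite J" using J finite_subset by blast
      have sJ: "s \<notin> J" using J by auto
      have "0 = (\<Sum>k<b. wedge (basis_vec (s + Suc j + k)) (\<omega> k) (insert s J))"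
        using j J s fin sJ q by (intro eq[symmetric]) auto
      also have "\<dots> = (\<Sum>k<b. - wedge (basis_vec (Suc s + j + k)) (\<eta> k) J)"
        using fin sJ
        by (intro sum.cong) (auto simp: wedge_basis_vec insert_sign_insert \<eta>_def insert_Diff_if)
      finally show "(\<Sum>k<b. wedge (basis_vec (Suc s + j + k)) (\<eta> k) J) = 0"
        by (simp add: sum_negf)
    qed
    then show ?thesis using I by (simp add: \<eta>_def insert_absorb)
  qed
  obtain b' where b: "b = Suc b'" using less.prems(4) by (cases b) auto
  have zeroth: "\<omega> 0 I = 0" if I: "I \<subseteq> {s..<n}" "card I = q" for I
  proof (cases "s \<in> I")
    case False
    have fin: "finite I" using I finite_subset by blast
    let ?J = "insert s I"
    have J: "?J \<subseteq> {s..<n}" "card ?J = Suc q" using I s fin False by auto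
    have sign: "insert_sign s ?J = (1 :: 'k)" using J(1) by (intro insert_sign_min) auto
    have "0 = (\<Sum>k<b. wedge (basis_vec (s + 0 + k)) (\<omega> k) ?J)"
      using J less.prems(1) by (intro eq[symmetric]) auto
    also have "\<dots> = wedge (basis_vec s) (\<omega> 0) ?J +
        (\<Sum>k<b'. wedge (basis_vec (s + Suc k)) (\<omega> (Suc k)) ?J)"
      unfolding b by (subst sum.lessThan_Suc_shift) simp
    also have "(\<Sum>k<b'. wedge (basis_vec (s + Suc k)) (\<omega> (Suc k)) ?J) = 0"
    proof (intro sum.neutral ballI wedge_eq_0 disjCI)
      fix k i assume "k \<in> {..<b'}" "i \<in> ?J" "\<omega> (Suc k) (?J - {i}) \<noteq> 0"
      moreover have "card (?J - {i}) = q" using \<open>i \<in> ?J\<close> J fin by simp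
      moreover have "?J - {i} \<subseteq> {s..<n}" using J by auto
      ultimately have "s \<notin> ?J - {i}" using through_s[of "Suc k" "?J - {i}"] b by blast
      then have "i = s" by auto
      then show "basis_vec (s + Suc k) i = (0 :: 'k)" by simp
    qed
    also have "wedge (basis_vec s) (\<omega> 0) ?J = \<omega> 0 I"
      using fin False sign by (simp add: wedge_basis_vec)
    finally show ?thesis by simp
  qed (use through_s b I in auto)
  show ?case
  proof (cases "s \<in> I \<or> k = 0")
    case False
    then obtain k' where k: "k = Suc k'" by (cases k) auto
    have "\<omega> (Suc k') I = 0"
    proof (rule less.hyps[where \<omega> = "\<lambda>k. \<omega> (Suc k)"])
      show "q + b' < q + b" "q < a" "Suc s + a + b' \<le> Suc n" "k' < b'" "card I = q"
        using less.prems b k by auto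
      show "I \<subseteq> {Suc s..<n}"
      proof
        fix i assume "i \<in> I"
        then have "s \<le> i" "i < n" "i \<noteq> s" using less.prems(5) False by auto
        then show "i \<in> {Suc s..<n}" by simp
      qed
      fix j J assume j: "j < a" and J: "J \<subseteq> {Suc s..<n}" "card J = Suc q"
      have sJ: "J \<subseteq> {s..<n}" using J by auto
      have "0 = (\<Sum>k<b. wedge (basis_vec (s + j + k)) (\<omega> k) J)"
        using j J sJ by (intro eq[symmetric])
      also have "\<dots> = wedge (basis_vec (s + j)) (\<omega> 0) J +
          (\<Sum>k<b'. wedge (basis_vec (Suc s + j + k)) (\<omega> (Suc k)) J)"
        unfolding b by (subst sum.lessThan_Suc_shift) simp
      also have "wedge (basis_vec (s + j)) (\<omega> 0) J = 0"
      proof (intro wedge_eq_0 disjI2 zeroth)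
        fix i assume "i \<in> J"
        then show "card (J - {i}) = q" using J by simp
      qed (use sJ in auto)
      finally show "(\<Sum>k<b'. wedge (basis_vec (Suc s + j + k)) (\<omega> (Suc k)) J) = 0" by simp
    qed
    then show ?thesis using k by simp
  qed (use through_s zeroth less.prems in auto)
qed

section \<open>The bordered Koszul flattening\<close>

lemma Q_mat_index:
  assumes "j < 2 * p + 2" "k < 2 * p + 2"
  shows "Q_mat p r $$ (j, k) = of_bool ((j \<le> p \<longleftrightarrow> k \<le> p) \<and> int j = int k + r)"
  using assms by (auto simp: Q_mat_def S_mat_def Let_def)

text \<open>
  The index \<open>2p + 1\<close>, just beyond the range of \<open>j\<close> and \<open>k\<close> in a tensor of size \<open>m\<close>, is that of the
  border.
\<close>

definition bordered :: "nat \<Rightarrow> (nat \<times> nat \<times> nat \<Rightarrow> 'k :: field) \<Rightarrow> nat \<Rightarrow> nat \<Rightarrow> nat \<Rightarrow> 'k" where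
  "bordered p t i j k = (if j \<le> 2 * p \<and> k \<le> 2 * p then t (i, j, k)
     else Q_mat p (int i - int p) $$ (j, k))"

definition flattening ::
    "nat \<Rightarrow> (nat \<times> nat \<times> nat \<Rightarrow> 'k :: field) \<Rightarrow> nat \<times> nat set \<Rightarrow> (nat \<times> nat set \<Rightarrow> 'k) \<Rightarrow> 'k" where
  "flattening p t = (\<lambda>(j, J) z. \<Sum>k<2 * p + 2. wedge (\<lambda>i. bordered p t i j k) (\<lambda>I. z (k, I)) J)"

lemma linear_form_flattening:
  assumes "J \<in> subsets_of_size n (Suc q)"
  shows "linear_form ({..<2 * p + 2} \<times> subsets_of_size n q) (flattening p t (j, J))"
  unfolding flattening_def prod.case
  using assms by (intro linear_form_sum linear_form_wedge)
    (auto intro: Diff_subsets_of_size simp: finite_subsets_of_size)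

lemma polynomial_flattening:
  assumes "J \<in> subsets_of_size (2 * p + 1) q"
  shows "(\<lambda>t. flattening p t (j, J) z)
    \<in> polynomial_funs ({..<2 * p + 1} \<times> {..<2 * p + 1} \<times> {..<2 * p + 1})"
proof -
  have "(\<lambda>t. bordered p t i j k) \<in> polynomial_funs ({..<2 * p + 1} \<times> {..<2 * p + 1} \<times> {..<2 * p + 1})"
    if "i \<in> J" for i k
    using that assms unfolding bordered_def
    by (cases "j \<le> 2 * p \<and> k \<le> 2 * p")
      (auto intro!: polynomial_funs.const polynomial_funs.coord simp: subsets_of_size_def)
  then show ?thesis
    unfolding flattening_def prod.case wedge_def
    by (intro polynomial_funs_sum polynomial_funs.mult polynomial_funs.const)
qed

text \<open>
  The entry \<open>(j, k)\<close> of \<open>Q\<^bsub>i-p\<^esub>\<close> is 1 exactly if \<open>j\<close> and \<open>k\<close> are in the same block and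
  \<open>i = j + (p - k)\<close>.  Reversing the order of the \<open>k\<close> in each block hence gives the Hankel system with
  \<open>a = b = p + 1\<close> and \<open>n = 2p + 1\<close>.
\<close>

lemma flattening_injective:
  fixes t :: "nat \<times> nat \<times> nat \<Rightarrow> 'k :: field"
  assumes t: "\<And>i j k. i \<le> 2 * p \<Longrightarrow> j \<le> 2 * p \<Longrightarrow> k \<le> 2 * p \<Longrightarrow>
      t (i, j, k) = Q_mat p (int i - int p) $$ (j, k)"
    and z: "\<And>j J. j < 2 * p + 2 \<Longrightarrow> J \<in> subsets_of_size (2 * p + 1) (Suc p) \<Longrightarrow>
      flattening p t (j, J) z = 0"
    and k: "k < 2 * p + 2" and I: "I \<in> subsets_of_size (2 * p + 1) p"
  shows "z (k, I) = 0"
proof -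
  \<comment> \<open>The two diagonal blocks are handled alike; \<open>h\<close> is the offset of the block.\<close>
  have block: "z (h + (p - k), I) = 0" if h: "h = 0 \<or> h = Suc p" and k: "k < Suc p" for h k
  proof (rule hankel_koszul_injective[where \<omega> = "\<lambda>k I. z (h + (p - k), I)" and s = 0
        and a = "Suc p" and b = "Suc p" and n = "2 * p + 1" and q = p])
    show "I \<subseteq> {0..<2 * p + 1}" "card I = p" using I by (auto simp: subsets_of_size_def)
    fix j J assume j: "j < Suc p" and J: "J \<subseteq> {0..<2 * p + 1}" "card J = Suc p"
    have J': "J \<in> subsets_of_size (2 * p + 1) (Suc p)" using J by (auto simp: subsets_of_size_def)
    let ?w = "\<lambda>k. wedge (\<lambda>i. bordered p t i (h + j) k) (\<lambda>I. z (k, I)) J"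
    have coeff: "bordered p t i (h + j) k =
        of_bool ((h + j \<le> p \<longleftrightarrow> k \<le> p) \<and> int (h + j) = int k + (int i - int p))"
      if "i \<in> J" "k < 2 * p + 2" for i k
    proof -
      have "i \<le> 2 * p" using that J by auto
      then show ?thesis
        using that(2) h j t[of i "h + j" k] Q_mat_index[of "h + j" p k "int i - int p", where 'a = 'k]
        by (auto simp: bordered_def)
    qed
    have "0 = (\<Sum>k<2 * p + 2. ?w k)"
      using z[of "h + j" J] J' h j by (auto simp: flattening_def)
    also have "\<dots> = (\<Sum>k\<in>{h..<h + Suc p}. ?w k)"
    proof (rule sum.mono_neutral_right)
      show "\<forall>k\<in>{..<2 * p + 2} - {h..<h + Suc p}. ?w k = 0"
        using h j by (intro ballI wedge_eq_0) (auto simp: coeff)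
    qed (use h in auto)
    also have "\<dots> = (\<Sum>k<Suc p. ?w (h + k))"
      using sum.shift_bounds_nat_ivl[of ?w 0 h "Suc p"] by (simp add: atLeast0LessThan add.commute)
    also have "\<dots> = (\<Sum>k<Suc p. ?w (h + (p - k)))"
      by (subst sum.nat_diff_reindex[symmetric]) simp
    also have "\<dots> = (\<Sum>k<Suc p. wedge (basis_vec (0 + j + k)) (\<lambda>I. z (h + (p - k), I)) J)"
    proof (intro sum.cong wedge_cong refl)
      fix k i assume "k \<in> {..<Suc p}" "i \<in> J"
      then show "bordered p t i (h + j) (h + (p - k)) = basis_vec (0 + j + k) i"
        using coeff[of i "h + (p - k)"] h j by auto
    qed
    finally show "(\<Sum>k<Suc p. wedge (basis_vec (0 + j + k)) (\<lambda>I. z (h + (p - k), I)) J) = 0" by simp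
  qed (use k in auto)
  show ?thesis
    using block[of 0 "p - k"] block[of "Suc p" "p - (k - Suc p)"] k by (cases "k \<le> p") auto
qed

text \<open>
  A nonzero kernel element is found by imposing fewer linear conditions than there are unknowns:
  the column conditions \<open>\<C>\<close> make the bordering column irrelevant, the row conditions \<open>\<R>\<close> are the
  equations of the bordering row, and \<open>\<P> l\<close> makes the \<open>l\<close>-th pure tensor contribute 0 to the
  remaining rows.
\<close>

lemma flattening_singular:
  fixes u v w :: "nat \<Rightarrow> nat \<Rightarrow> 'k :: field_char_0"
  assumes t: "\<And>i j k. t (i, j, k) = (\<Sum>l<r. u l i * v l j * w l k)"
    and r: "r + 2 \<le> 4 * p"
  shows "\<exists>z. (\<exists>x \<in> {..<2 * p + 2} \<times> subsets_of_size (2 * p + 1) p. z x \<noteq> 0) \<and>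
    (\<forall>y \<in> {..<2 * p + 2} \<times> subsets_of_size (2 * p + 1) (Suc p). flattening p t y z = 0)"
proof -
  define m where "m = 2 * p + 1"
  let ?X = "{..<2 * p + 2} \<times> subsets_of_size m p"
  obtain \<iota> where \<iota>: "\<And>l. \<iota> l < m" "\<And>l \<omega> J. (\<forall>J \<in> subsets_of_size m (Suc p). \<iota> l \<in> J \<longrightarrow> wedge (u l) \<omega> J = 0)
      \<Longrightarrow> J \<in> subsets_of_size m (Suc p) \<Longrightarrow> wedge (u l) \<omega> J = 0"
    using wedge_pivot[of m p "u _"] unfolding m_def by (metis Suc_eq_plus1 zero_less_Suc)
  define \<Omega> where "\<Omega> l z I = (\<Sum>k<m. w l k * z (k, I))" for l and z :: "nat \<times> nat set \<Rightarrow> 'k" and I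
  define \<C> where "\<C> = (\<lambda>I z. z (m, I) :: 'k) ` subsets_of_size m p"
  define \<R> where "\<R> = (\<lambda>J. flattening p t (m, J)) ` subsets_of_size m (Suc p)"
  define \<P> where "\<P> l = (\<lambda>J z. wedge (u l) (\<Omega> l z) J) ` {J \<in> subsets_of_size m (Suc p). \<iota> l \<in> J}" for l
  define \<F> where "\<F> = \<C> \<union> \<R> \<union> (\<Union>l<r. \<P> l)"
  have finX: "finite ?X" by (simp add: finite_subsets_of_size)
  have fin: "finite \<C>" "finite \<R>" "finite (\<P> l)" for l
    by (simp_all add: \<C>_def \<R>_def \<P>_def finite_subsets_of_size)
  have "\<exists>z. (\<exists>x\<in>?X. z x \<noteq> 0) \<and> (\<forall>F\<in>\<F>. F z = 0)"
  proof (rule underdetermined_system_has_solution[OF finX])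
    show "finite \<F>" using fin by (simp add: \<F>_def)
    have choose_sym: "m choose Suc p = m choose p"
      using binomial_symmetric[of p m] by (simp add: m_def)
    have "card \<C> \<le> m choose p" "card \<R> \<le> m choose p"
      unfolding \<C>_def \<R>_def
      by (rule order_trans[OF card_image_le], simp_all add: finite_subsets_of_size card_subsets_of_size choose_sym)+
    moreover have "card (\<Union>l<r. \<P> l) \<le> r * (2 * p choose p)"
    proof -
      have "card (\<P> l) \<le> 2 * p choose p" for l
        unfolding \<P>_def using card_subsets_of_size_through[OF \<iota>(1)[of l], of p]
        by (intro order_trans[OF card_image_le]) (simp_all add: finite_subsets_of_size m_def)
      then have "(\<Sum>l<r. card (\<P> l)) \<le> (\<Sum>l<r. 2 * p choose p)" by (rule sum_mono)
      then show ?thesis using card_UN_le[of "{..<r}" \<P>] by simp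
    qed
    ultimately have "card \<F> \<le> 2 * (m choose p) + r * (2 * p choose p)"
      unfolding \<F>_def using card_Un_le[of "\<C> \<union> \<R>" "\<Union>l<r. \<P> l"] card_Un_le[of \<C> \<R>] by linarith
    also have "\<dots> < (2 * p + 2) * (m choose p)"
    proof -
      have ratio: "Suc p * (m choose p) = m * (2 * p choose p)"
        using Suc_times_binomial_eq[of "2 * p" p] choose_sym by (simp add: m_def)
      have "Suc p * (r * (2 * p choose p)) < 2 * p * m * (2 * p choose p)"
      proof -
        have "Suc p * r < 2 * p * m"
        proof -
          have "Suc p * r + 2 * Suc p \<le> Suc p * (4 * p)"
            using mult_le_mono2[OF r, of "Suc p"] by (simp only: distrib_left mult.commute)
          then show ?thesis by (simp add: m_def algebra_simps)
        qed
        then show ?thesis by (simp add: mult.assoc[symmetric])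
      qed
      also have "\<dots> = 2 * p * (Suc p * (m choose p))"
        unfolding ratio by (simp only: mult.assoc)
      also have "\<dots> = Suc p * (2 * p * (m choose p))" by (simp only: mult_ac)
      finally have "r * (2 * p choose p) < 2 * p * (m choose p)"
        by (simp only: Suc_mult_less_cancel1)
      then show ?thesis by (simp add: algebra_simps)
    qed
    also have "\<dots> = card ?X" by (simp add: card_subsets_of_size card_cartesian_product)
    finally show "card \<F> < card ?X" .
    fix F assume "F \<in> \<F>"
    moreover have "linear_form ?X (\<lambda>z. z (m, I) :: 'k)" if "I \<in> subsets_of_size m p" for I
      using that finX by (intro linear_form_coord) (auto simp: m_def)
    moreover have "linear_form ?X (\<lambda>z. wedge (u l) (\<Omega> l z) J)" if "J \<in> subsets_of_size m (Suc p)" for l J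
      unfolding \<Omega>_def wedge_sum_right using that finX
      by (intro linear_form_sum linear_form_scale linear_form_wedge)
        (auto simp: m_def intro: Diff_subsets_of_size)
    moreover have "linear_form ?X (flattening p t (j, J))" if "J \<in> subsets_of_size m (Suc p)" for j J
      using that by (rule linear_form_flattening)
    ultimately show "linear_form ?X F"
      unfolding \<F>_def \<C>_def \<R>_def \<P>_def by blast
  qed
  then obtain z where nz: "\<exists>x\<in>?X. z x \<noteq> 0" and z: "\<And>F. F \<in> \<F> \<Longrightarrow> F z = 0" by blast
  have col: "z (m, I) = 0" if "I \<in> subsets_of_size m p" for I
    using z[of "\<lambda>z. z (m, I)"] that by (auto simp: \<F>_def \<C>_def)
  have row: "flattening p t (m, J) z = 0" if "J \<in> subsets_of_size m (Suc p)" for J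
    using z[of "flattening p t (m, J)"] that by (auto simp: \<F>_def \<R>_def)
  have pure: "wedge (u l) (\<Omega> l z) J = 0" if "l < r" "J \<in> subsets_of_size m (Suc p)" for l J
  proof (rule \<iota>(2)[OF _ that(2)], intro ballI impI)
    fix J assume "J \<in> subsets_of_size m (Suc p)" "\<iota> l \<in> J"
    then have "(\<lambda>z. wedge (u l) (\<Omega> l z) J) \<in> \<F>" using that by (auto simp: \<F>_def \<P>_def)
    then show "wedge (u l) (\<Omega> l z) J = 0" by (rule z)
  qed
  have "flattening p t (j, J) z = 0" if j: "j < m" and J: "J \<in> subsets_of_size m (Suc p)" for j J
  proof -
    let ?z = "\<lambda>k I. z (k, I)"
    have m: "2 * p + 2 = Suc m" by (simp add: m_def)
    have "flattening p t (j, J) z = (\<Sum>k<m. wedge (\<lambda>i. bordered p t i j k) (?z k) J) +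
        wedge (\<lambda>i. bordered p t i j m) (?z m) J"
      unfolding flattening_def prod.case m by simp
    also have "wedge (\<lambda>i. bordered p t i j m) (?z m) J = 0"
      using Diff_subsets_of_size[OF J] by (intro wedge_eq_0 disjI2 col)
    also have "(\<Sum>k<m. wedge (\<lambda>i. bordered p t i j k) (?z k) J) =
        (\<Sum>k<m. \<Sum>l<r. v l j * (w l k * wedge (u l) (?z k) J))"
    proof (rule sum.cong[OF refl])
      fix k assume "k \<in> {..<m}"
      then have "wedge (\<lambda>i. bordered p t i j k) (?z k) J =
          wedge (\<lambda>i. \<Sum>l<r. v l j * (w l k * u l i)) (?z k) J"
        using j by (intro wedge_cong) (auto simp: bordered_def t m_def mult_ac)
      then show "wedge (\<lambda>i. bordered p t i j k) (?z k) J =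
          (\<Sum>l<r. v l j * (w l k * wedge (u l) (?z k) J))"
        by (simp add: wedge_sum_left wedge_scale_left)
    qed
    also have "\<dots> = (\<Sum>l<r. v l j * wedge (u l) (\<Omega> l z) J)"
      unfolding \<Omega>_def wedge_sum_right by (subst sum.swap) (simp add: sum_distrib_left)
    also have "\<dots> = 0" using pure J by simp
    finally show ?thesis by simp
  qed
  then have "flattening p t y z = 0" if "y \<in> {..<2 * p + 2} \<times> subsets_of_size m (Suc p)" for y
    using that row by (cases y) (auto simp: m_def less_Suc_eq)
  then show ?thesis using nz unfolding m_def by blast
qed

section \<open>Tensor rank and border rank\<close>

lemma pure_tensorsE:
  assumes "t \<in> pure_tensors m"
  obtains u v w where "\<And>i j k. t (i, j, k) = u i * v j * w k"
  using assms unfolding pure_tensors_def tensor_prod_def by (auto simp: mult.assoc)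

lemma pure_tensors_point_mass:
  assumes "a < m" "b < m" "c < m"
  shows "(\<lambda>x. if x = (a, b, c) then d else 0 :: 'k :: field) \<in> pure_tensors m"
proof -
  have "(\<lambda>x. if x = (a, b, c) then d else 0) =
    vec_coords (d \<cdot>\<^sub>v unit_vec m a) \<otimes>\<^sub>t vec_coords (unit_vec m b) \<otimes>\<^sub>t vec_coords (unit_vec m c)"
    using assms by (auto simp: fun_eq_iff tensor_prod_def vec_coords_def)
  then show ?thesis unfolding pure_tensors_def by (auto intro!: exI)
qed

text \<open>Every tensor is a sum of pure tensors, so the minimum that defines the rank is attained.\<close>

lemma tensor_rank_attained:
  fixes T :: "nat \<times> nat \<times> nat \<Rightarrow> 'k :: field"
  assumes "T \<in> tensor_space m"
  obtains t where "\<And>l. l < tensor_rank m T \<Longrightarrow> t l \<in> pure_tensors m"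
    and "T = (\<lambda>x. \<Sum>l<tensor_rank m T. t l x)"
proof -
  let ?B = "{..<m} \<times> {..<m} \<times> {..<m}"
  obtain h where h: "bij_betw h {..<card ?B} ?B"
    using ex_bij_betw_nat_finite[of ?B] by (auto simp: atLeast0LessThan)
  define t where "t l x = (if x = h l then T (h l) else 0)" for l x
  have pure: "t l \<in> pure_tensors m" if "l < card ?B" for l
  proof -
    obtain a b c where "h l = (a, b, c)" by (cases "h l") auto
    moreover have "h l \<in> ?B" using bij_betwE[OF h] that by auto
    ultimately show ?thesis unfolding t_def using pure_tensors_point_mass[of a m b c] by auto
  qed
  have total: "T = (\<lambda>x. \<Sum>l<card ?B. t l x)"
  proof
    fix x
    have "(\<Sum>l<card ?B. t l x) = (\<Sum>y\<in>?B. if x = y then T y else 0)"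
      unfolding t_def by (rule sum.reindex_bij_betw[OF h])
    also have "\<dots> = (if x \<in> ?B then T x else 0)" by (intro sum.delta') simp
    also have "\<dots> = T x" using assms unfolding tensor_space_def coord_space_def by (cases x) auto
    finally show "T x = (\<Sum>l<card ?B. t l x)" by simp
  qed
  have "\<exists>(r :: nat) t. (\<forall>l<r. t l \<in> pure_tensors m) \<and> T = (\<lambda>x. \<Sum>l<r. t l x)"
    by (intro exI[of _ "card ?B"] exI[of _ t] conjI allI impI pure total)
  from LeastI_ex[OF this] show ?thesis unfolding tensor_rank_def[symmetric] using that by blast
qed

lemma border_rank_attained:
  assumes "T \<in> tensor_space m"
  shows "T \<in> zariski_closure ({..<m} \<times> {..<m} \<times> {..<m}) (rank_le m (border_rank m T))"
  unfolding border_rank_def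
proof (rule LeastI)
  have "T \<in> rank_le m (tensor_rank m T)" using assms by (simp add: rank_le_def)
  then show "T \<in> zariski_closure ({..<m} \<times> {..<m} \<times> {..<m}) (rank_le m (tensor_rank m T))"
    unfolding zariski_closure_def by (meson hull_subset subsetD)
qed

theorem proposition6p3:
  fixes p m :: nat and T :: "nat \<times> nat \<times> nat \<Rightarrow> 'k :: field_char_0"
  assumes m: "m = 2 * p + 1"
    and T: "T = (\<lambda>x. \<Sum>i = 1..m.
      (vec_coords (unit_vec m (i - 1)) \<otimes>\<^sub>t mat_coords (Q_tilde p (int i - int p - 1))) x)"
  shows "int (border_rank m T) \<ge> 2 * int m - 3"
proof (rule ccontr)
  assume "\<not> int (border_rank m T) \<ge> 2 * int m - 3"
  then have small: "border_rank m T + 2 \<le> 4 * p" using m by simp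
  let ?B = "{..<2 * p + 1} \<times> {..<2 * p + 1} \<times> {..<2 * p + 1}"
  have dim: "dim_row (Q_tilde p r :: 'k mat) = m" "dim_col (Q_tilde p r :: 'k mat) = m" for r
    by (simp_all add: m Q_tilde_def Q_mat_def S_mat_def Let_def)
  have T_entry: "T (i, j, k) = (if i < m \<and> j < m \<and> k < m
      then Q_mat p (int i - int p) $$ (j, k) else 0)" for i j k
  proof -
    have "T (i, j, k) = (\<Sum>i' = 1..m. if i' = Suc i
        then mat_coords (Q_tilde p (int i - int p)) (j, k) else 0)"
      unfolding T by (intro sum.cong) (auto simp: tensor_prod_def vec_coords_def)
    also have "\<dots> = (if i < m then mat_coords (Q_tilde p (int i - int p)) (j, k) else 0)" by auto
    also have "mat_coords (Q_tilde p (int i - int p)) (j, k) =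
        (if j < m \<and> k < m then Q_mat p (int i - int p) $$ (j, k) else 0 :: 'k)"
      unfolding mat_coords_def by (auto simp: dim) (auto simp: Q_tilde_def mat_delete_def m Q_mat_def S_mat_def Let_def)
    finally show ?thesis by auto
  qed
  have T_space: "T \<in> tensor_space m"
    unfolding tensor_space_def coord_space_def by (auto simp: T_entry)
  let ?X = "{..<2 * p + 2} \<times> subsets_of_size (2 * p + 1) p"
  let ?Y = "{..<2 * p + 2} \<times> subsets_of_size (2 * p + 1) (Suc p)"
  have "(2 * p + 1) choose Suc p = (2 * p + 1) choose p"
    using binomial_symmetric[of p "2 * p + 1"] by simp
  then have card: "card ?Y = card ?X" by (simp add: card_cartesian_product card_subsets_of_size)
  obtain f where f: "f \<in> polynomial_funs ?B"
    and f_0: "\<And>t :: nat \<times> nat \<times> nat \<Rightarrow> 'k. f t = 0 \<longleftrightarrow>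
      (\<exists>z. (\<exists>x\<in>?X. z x \<noteq> 0) \<and> (\<forall>y\<in>?Y. flattening p t y z = 0))"
  proof (rule singular_locus_polynomial[of ?X ?Y "flattening p" ?B])
    show "finite ?X" "finite ?Y" by (simp_all add: finite_subsets_of_size)
    show "card ?Y = card ?X" by (rule card)
    show "linear_form ?X (flattening p t y)" if "y \<in> ?Y" for t :: "nat \<times> nat \<times> nat \<Rightarrow> 'k" and y
      using that linear_form_flattening by (cases y) blast
    show "(\<lambda>t. flattening p t y z) \<in> polynomial_funs ?B" if "y \<in> ?Y"
      for y and z :: "nat \<times> nat set \<Rightarrow> 'k"
      using that polynomial_flattening by (cases y) blast
  qed blast
  have "f T = 0"
  proof (rule polynomial_fun_vanishes_on_zariski_closure[OF f])
    show "T \<in> zariski_closure ?B (rank_le m (border_rank m T))"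
      using border_rank_attained[OF T_space] by (simp add: m)
    show "rank_le m (border_rank m T) \<subseteq> coord_space ?B"
      by (auto simp: rank_le_def tensor_space_def m)
    fix t :: "nat \<times> nat \<times> nat \<Rightarrow> 'k" assume t: "t \<in> rank_le m (border_rank m T)"
    let ?r = "tensor_rank m t"
    obtain s where s: "\<And>l. l < ?r \<Longrightarrow> s l \<in> pure_tensors m" "t = (\<lambda>x. \<Sum>l<?r. s l x)"
      using t tensor_rank_attained unfolding rank_le_def by blast
    have "\<exists>u v w. \<forall>i j k. s l (i, j, k) = u i * v j * w k" if "l < ?r" for l
      using pure_tensorsE[OF s(1)[OF that]] by metis
    then obtain u v w where "\<And>l i j k. l < ?r \<Longrightarrow> s l (i, j, k) = u l i * v l j * w l k"
      by metis
    then have "t (i, j, k) = (\<Sum>l<?r. u l i * v l j * w l k)" for i j k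
      by (subst s(2)) simp
    moreover have "?r + 2 \<le> 4 * p" using t small by (simp add: rank_le_def)
    ultimately show "f t = 0" unfolding f_0 by (rule flattening_singular)
  qed
  then obtain z x where "x \<in> ?X" "z x \<noteq> 0" "\<forall>y\<in>?Y. flattening p T y z = 0"
    unfolding f_0 by blast
  then show False
    using flattening_injective[of p T z "fst x" "snd x"] by (cases x) (auto simp: T_entry m)
qed

end
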